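(* Let $\Omega$ be a semigroup and let $(D,\{\theta_k\}_{k\geq1})$ be a Dend$_\infty$-family algebra over a field ${\bf k}$ of characteristic $0$. Then $(D,\{\nu_k\}_{k\geq1})$ is an $\Omega$-$A_\infty$-algebra, where $$(\nu_k)_{\alpha_1,\ldots,\alpha_k}(x_1,\ldots,x_k)=\sum_{r=1}^k(\theta_k)^{[r]}_{\alpha_1,\ldots,\alpha_k}(x_1,\ldots,x_k),$$ for $\alpha_1,\ldots,\alpha_k\in\Omega$ and $x_1,\ldots,x_k\in D$.
   Context: All vector spaces and linear maps are over a field ${\bf k}$ of characteristic $0$; $\Omega$ is a semigroup. A subscript $\alpha_1,\ldots,\alpha_i\cdots\alpha_{i+l-1},\ldots,\alpha_n$ means that the labels $\alpha_i,\ldots,\alpha_{i+l-1}$ are replaced by their product in $\Omega$. Dend$_\infty$-family algebra. Let $D=\oplus_{i\in\mathbb{Z}}D_i$ be a graded vector space and $C_n=\{[1],\ldots,[n]\}$ for $n\geq 1$. $\mathrm{Hom}^1_{\widehat\Omega}({\bf k}[C_k]\otimes D^{\otimes k},D)$ is the set of collections $\theta_k=\{(\theta_k)_{\alpha_1,\ldots,\alpha_k}:{\bf k}[C_k]\otimes D^{\otimes k}\to D\}_{\alpha_1,\ldots,\alpha_k\in\Omega}$ of linear maps such that, writing $(\theta_k)^{[r]}_{\alpha_1,\ldots,\alpha_k}:=(\theta_k)_{\alpha_1,\ldots,\alpha_k}([r];-,\ldots,-):D^{\otimes k}\to D$, each $(\theta_k)^{[r]}_{\alpha_1,\ldots,\alpha_k}$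 has degree $1$ and does not depend on $\alpha_r$, for all $1\leq r\leq k$. A Dend$_\infty$-family algebra is a pair $(D,\{\theta_k\}_{k\geq1})$ with $\theta_k\in\mathrm{Hom}^1_{\widehat\Omega}({\bf k}[C_k]\otimes D^{\otimes k},D)$ satisfying, for all $n\geq1$, $[r]\in C_n$, $\alpha_1,\ldots,\alpha_n\in\Omega$ and homogeneous $x_1,\ldots,x_n\in D$, $$\sum_{k+l=n+1}\sum_{i=1}^k(\theta_k\diamond_i\theta_l)^{[r]}_{\alpha_1,\ldots,\alpha_n}(x_1,\ldots,x_n)=0,$$ where, with $\varepsilon=(-1)^{|x_1|+\cdots+|x_{i-1}|}$, $(\theta_k\diamond_i\theta_l)^{[r]}_{\alpha_1,\ldots,\alpha_n}(x_1,\ldots,x_n)$ equals - $\varepsilon\,(\theta_k)^{[r]}_{\alpha_1,\ldots,\alpha_i\cdots\alpha_{i+l-1},\ldots,\alpha_n}\big(x_1,\ldots,x_{i-1},\sum_{s=1}^l(\theta_l)^{[s]}_{\alpha_i,\ldots,\alpha_{i+l-1}}(x_i,\ldots,x_{i+l-1}),x_{i+l},\ldots,x_n\big)$ if $1\leq r\leq i-1$; - $\varepsilon\,(\theta_k)^{[i]}_{\alpha_1,\ldots,\alpha_i\cdots\alpha_{i+l-1},\ldots,\alpha_n}\big(x_1,\ldots,x_{i-1},(\theta_l)^{[r-i+1]}_{\alpha_i,\ldots,\alpha_{i+l-1}}(x_i,\ldots,x_{i+l-1}),x_{i+l},\ldots,x_n\big)$ if $i\leq r\leq i+l-1$; - $\varepsilon\,(\theta_k)^{[r-l+1]}_{\alpha_1,\ldots,\alpha_i\cdots\alpha_{i+l-1},\ldots,\alpha_n}\big(x_1,\ldots,x_{i-1},\sum_{s=1}^l(\theta_l)^{[s]}_{\alpha_i,\ldots,\alpha_{i+l-1}}(x_i,\ldots,x_{i+l-1}),x_{i+l},\ldots,x_n\big)$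 if $i+l\leq r\leq n$. An $\Omega$-$A_\infty$-algebra is a graded vector space $A$ with, for each $k\geq1$, a collection $\nu_k=\{(\nu_k)_{\alpha_1,\ldots,\alpha_k}:A^{\otimes k}\to A\}_{\alpha_1,\ldots,\alpha_k\in\Omega}$ of degree $1$ linear maps such that for all $n\geq1$, $\alpha_1,\ldots,\alpha_n\in\Omega$ and homogeneous $a_1,\ldots,a_n\in A$ $$\sum_{k+l=n+1}\sum_{i=1}^k(-1)^{|a_1|+\cdots+|a_{i-1}|}(\nu_k)_{\alpha_1,\ldots,\alpha_i\cdots\alpha_{i+l-1},\ldots,\alpha_n}\big(a_1,\ldots,a_{i-1},(\nu_l)_{\alpha_i,\ldots,\alpha_{i+l-1}}(a_i,\ldots,a_{i+l-1}),a_{i+l},\ldots,a_n\big)=0.$$ *)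

theory Defs
  imports Complex_Main
begin

text \<open>
  A linear map on a \<open>k\<close>-fold tensor power is represented by the multilinear map
  it corresponds to, evaluated on lists of length \<open>k\<close>.  Labels in \<open>\<Omega>\<close> are also passed
  as lists of length \<open>k\<close>.  Positions are counted from 1.
\<close>

definition block :: "nat \<Rightarrow> nat \<Rightarrow> 'a list \<Rightarrow> 'a list" where
  "block i l xs = take l (drop (i - 1) xs)"

definition replace_block :: "nat \<Rightarrow> nat \<Rightarrow> 'a list \<Rightarrow> 'a \<Rightarrow> 'a list" where
  "replace_block i l xs y = take (i - 1) xs @ [y] @ drop (i - 1 + l) xs"

text \<open>A semigroup has no empty product; this is only used on nonempty lists.\<close>

definition semigroup_prod :: "'w::semigroup_mult list \<Rightarrow> 'w" where
  "semigroup_prod ws = foldl (*) (hd ws) (tl ws)"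

definition merge_labels :: "nat \<Rightarrow> nat \<Rightarrow> 'w::semigroup_mult list \<Rightarrow> 'w list" where
  "merge_labels i l ws = replace_block i l ws (semigroup_prod (block i l ws))"

locale graded_vector_space = vector_space scale
  for scale :: "'k::field_char_0 \<Rightarrow> 'd::ab_group_add \<Rightarrow> 'd" (infixr "*s" 75) +
  fixes D :: "int \<Rightarrow> 'd set"
  assumes subspace_component: "subspace (D i)"
    and direct_sum:
      "\<exists>!c :: int \<Rightarrow> 'd. (\<forall>i. c i \<in> D i) \<and> finite {i. c i \<noteq> 0} \<and> x = (\<Sum>i\<in>{i. c i \<noteq> 0}. c i)"
begin

text \<open>
  Degrees are carried separately from the elements because \<open>0\<close> is homogeneous of every degree.
\<close>

definition homogeneous :: "int list \<Rightarrow> 'd list \<Rightarrow> bool" where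
  "homogeneous ds xs \<longleftrightarrow> list_all2 (\<lambda>d x. x \<in> D d) ds xs"

definition multilinear :: "nat \<Rightarrow> ('d list \<Rightarrow> 'd) \<Rightarrow> bool" where
  "multilinear k f \<longleftrightarrow>
     (\<forall>xs ys. length xs + 1 + length ys = k \<longrightarrow> Vector_Spaces.linear scale scale (\<lambda>x. f (xs @ [x] @ ys)))"

definition degree_one :: "nat \<Rightarrow> ('d list \<Rightarrow> 'd) \<Rightarrow> bool" where
  "degree_one k f \<longleftrightarrow>
     (\<forall>ds xs. length xs = k \<longrightarrow> homogeneous ds xs \<longrightarrow> f xs \<in> D (sum_list ds + 1))"

definition koszul_sign :: "nat \<Rightarrow> int list \<Rightarrow> 'k" where
  "koszul_sign i ds = (-1) powi sum_list (take (i - 1) ds)"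

text \<open>
  A linear map on \<open>k[C\<^sub>k] \<otimes> D\<^sup>\<otimes>\<^sup>k\<close> is given by its restrictions \<open>f r\<close> to the basis elements
  \<open>[r]\<close> of \<open>k[C\<^sub>k]\<close>, for \<open>1 \<le> r \<le> k\<close>.
\<close>

definition Hom1_family :: "nat \<Rightarrow> (nat \<Rightarrow> 'w list \<Rightarrow> 'd list \<Rightarrow> 'd) \<Rightarrow> bool" where
  "Hom1_family k f \<longleftrightarrow>
     (\<forall>r\<in>{1..k}. \<forall>\<alpha>. length \<alpha> = k \<longrightarrow>
        multilinear k (f r \<alpha>) \<and> degree_one k (f r \<alpha>) \<and>
        (\<forall>\<omega> xs. length xs = k \<longrightarrow> f r (\<alpha>[r - 1 := \<omega>]) xs = f r \<alpha> xs))"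

text \<open>
  The argument \<open>l\<close> is the arity of \<open>g\<close>, and \<open>ds\<close> lists the degrees of \<open>xs\<close>.
\<close>

definition diamond ::
  "nat \<Rightarrow> nat \<Rightarrow> (nat \<Rightarrow> 'w::semigroup_mult list \<Rightarrow> 'd list \<Rightarrow> 'd) \<Rightarrow> (nat \<Rightarrow> 'w list \<Rightarrow> 'd list \<Rightarrow> 'd)
    \<Rightarrow> nat \<Rightarrow> 'w list \<Rightarrow> int list \<Rightarrow> 'd list \<Rightarrow> 'd" where
  "diamond i l f g r \<alpha> ds xs =
     koszul_sign i ds *s
       (if r < i then
          f r (merge_labels i l \<alpha>)
            (replace_block i l xs (\<Sum>s=1..l. g s (block i l \<alpha>) (block i l xs)))
        else if r < i + l then
          f i (merge_labels i l \<alpha>)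
            (replace_block i l xs (g (r - i + 1) (block i l \<alpha>) (block i l xs)))
        else
          f (r - l + 1) (merge_labels i l \<alpha>)
            (replace_block i l xs (\<Sum>s=1..l. g s (block i l \<alpha>) (block i l xs))))"

end

locale Dend_inf_family_algebra = graded_vector_space scale D
  for scale :: "'k::field_char_0 \<Rightarrow> 'd::ab_group_add \<Rightarrow> 'd" (infixr "*s" 75)
    and D :: "int \<Rightarrow> 'd set" +
  fixes \<theta> :: "nat \<Rightarrow> nat \<Rightarrow> 'w::semigroup_mult list \<Rightarrow> 'd list \<Rightarrow> 'd"
  assumes Hom1_theta: "1 \<le> k \<Longrightarrow> Hom1_family k (\<theta> k)"
    and Dend_inf_relation:
      "\<lbrakk>1 \<le> n; 1 \<le> r; r \<le> n; length \<alpha> = n; length xs = n; homogeneous ds xs\<rbrakk> \<Longrightarrow>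
       (\<Sum>(k, l)\<in>{(k, l). 1 \<le> k \<and> 1 \<le> l \<and> k + l = n + 1}. \<Sum>i=1..k.
          diamond i l (\<theta> k) (\<theta> l) r \<alpha> ds xs) = 0"

locale Omega_A_inf_algebra = graded_vector_space scale A
  for scale :: "'k::field_char_0 \<Rightarrow> 'd::ab_group_add \<Rightarrow> 'd" (infixr "*s" 75)
    and A :: "int \<Rightarrow> 'd set" +
  fixes \<nu> :: "nat \<Rightarrow> 'w::semigroup_mult list \<Rightarrow> 'd list \<Rightarrow> 'd"
  assumes multilinear_nu: "\<lbrakk>1 \<le> k; length \<alpha> = k\<rbrakk> \<Longrightarrow> multilinear k (\<nu> k \<alpha>)"
    and degree_nu: "\<lbrakk>1 \<le> k; length \<alpha> = k\<rbrakk> \<Longrightarrow> degree_one k (\<nu> k \<alpha>)"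
    and A_inf_relation:
      "\<lbrakk>1 \<le> n; length \<alpha> = n; length xs = n; homogeneous ds xs\<rbrakk> \<Longrightarrow>
       (\<Sum>(k, l)\<in>{(k, l). 1 \<le> k \<and> 1 \<le> l \<and> k + l = n + 1}. \<Sum>i=1..k.
          koszul_sign i ds *s
            \<nu> k (merge_labels i l \<alpha>)
              (replace_block i l xs (\<nu> l (block i l \<alpha>) (block i l xs)))) = 0"

end

theory Submission
  imports Defs
begin

text \<open>
  Summing the Dend$_\infty$-family relations over the colour \<open>r \<in> {1..n}\<close> gives the relation
  for \<open>\<nu>\<close>. For fixed \<open>k\<close>, \<open>l\<close>, \<open>i\<close> the colours \<open>r < i\<close> and \<open>r \<ge> i + l\<close> run through the
  colours of \<open>\<theta>\<^sub>k\<close> other than \<open>i\<close>, each with the full sum over \<open>\<theta>\<^sub>l\<close> inserted, while by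
  linearity in slot \<open>i\<close> the colours in between add up to the missing term of colour \<open>i\<close>.
\<close>

lemma length_replace_block:
  "\<lbrakk>1 \<le> i; i + l \<le> length xs + 1\<rbrakk> \<Longrightarrow> length (replace_block i l xs y) = length xs + 1 - l"
  by (simp add: replace_block_def)

text \<open>The cuts at \<open>i\<close> and \<open>i + l\<close> are those of the case distinction
  in \<open>diamond\<close>. The middle range is renumbered by the colours of the inserted
  operation, the last one by the colours above \<open>i\<close> of the outer operation.\<close>

lemma sum_split_block:
  fixes f :: "nat \<Rightarrow> 'a::comm_monoid_add"
  assumes "1 \<le> i" and "i \<le> k"
  shows "(\<Sum>r=1..k + l - 1. f r) =
    (\<Sum>r\<in>{1..<i}. f r) + (\<Sum>s=1..l. f (s + i - 1)) + (\<Sum>r\<in>{i<..k}. f (r + l - 1))"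
proof -
  have "(\<Sum>r=1..k + l - 1. f r) = (\<Sum>r\<in>{1..<k + l}. f r)"
    using assms by (intro sum.cong) auto
  also have "\<dots> = (\<Sum>r\<in>{1..<i}. f r) + (\<Sum>r\<in>{i..<i + l}. f r) + (\<Sum>r\<in>{i + l..<k + l}. f r)"
    using assms by (simp add: sum.atLeastLessThan_concat)
  also have "(\<Sum>r\<in>{i..<i + l}. f r) = (\<Sum>s=1..l. f (s + i - 1))"
    using assms by (intro sum.reindex_bij_witness[of _ "\<lambda>s. s + i - 1" "\<lambda>r. r - i + 1"]) auto
  also have "(\<Sum>r\<in>{i + l..<k + l}. f r) = (\<Sum>r\<in>{i<..k}. f (r + l - 1))"
    using assms by (intro sum.reindex_bij_witness[of _ "\<lambda>r. r + l - 1" "\<lambda>r. r - l + 1"]) auto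
  finally show ?thesis .
qed

context graded_vector_space
begin

lemma multilinear_sum:
  assumes "\<And>r. r \<in> R \<Longrightarrow> multilinear k (f r)"
  shows "multilinear k (\<lambda>xs. \<Sum>r\<in>R. f r xs)"
proof -
  interpret vector_space_pair scale scale ..
  show ?thesis
    using assms unfolding multilinear_def by (intro allI impI linear_compose_sum) blast
qed

lemma degree_one_sum:
  assumes "\<And>r. r \<in> R \<Longrightarrow> degree_one k (f r)"
  shows "degree_one k (\<lambda>xs. \<Sum>r\<in>R. f r xs)"
  using assms unfolding degree_one_def by (blast intro: subspace_sum[OF subspace_component])

lemma multilinear_replace_block_sum:
  assumes "multilinear k f" and "1 \<le> i" and "i \<le> k" and "k + l = length xs + 1"
  shows "f (replace_block i l xs (\<Sum>s\<in>S. y s)) = (\<Sum>s\<in>S. f (replace_block i l xs (y s)))"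
proof -
  \<comment> \<open>Replacing a block of length \<open>l\<close> leaves \<open>k\<close> arguments,
    so slot \<open>i\<close> of \<open>f\<close> is linear with the entries around the block held
    fixed.\<close>
  have "length (take (i - 1) xs) + 1 + length (drop (i - 1 + l) xs) = k"
    using assms(2-) by simp
  then interpret Vector_Spaces.linear scale scale
      "\<lambda>x. f (take (i - 1) xs @ [x] @ drop (i - 1 + l) xs)"
    using assms(1) unfolding multilinear_def by blast
  show ?thesis
    unfolding replace_block_def by (rule sum)
qed

text \<open>Multilinearity is asked at colour \<open>i\<close> only: in the other branches of
  \<open>diamond\<close> the inserted element is already the full sum over \<open>s\<close>.\<close>

lemma sum_diamond:
  assumes multilin: "multilinear k (f i (merge_labels i l \<alpha>))"
    and i: "1 \<le> i" "i \<le> k" and len: "k + l = length xs + 1"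
  shows "(\<Sum>r=1..length xs. diamond i l f g r \<alpha> ds xs) =
    koszul_sign i ds *s
      (\<Sum>r=1..k. f r (merge_labels i l \<alpha>)
        (replace_block i l xs (\<Sum>s=1..l. g s (block i l \<alpha>) (block i l xs))))"
proof -
  let ?y = "\<lambda>s. g s (block i l \<alpha>) (block i l xs)"
  let ?F = "\<lambda>r y. f r (merge_labels i l \<alpha>) (replace_block i l xs y)"
  let ?Y = "\<Sum>s=1..l. ?y s"
  let ?h = "\<lambda>r. if r < i then ?F r ?Y else if r < i + l then ?F i (?y (r - i + 1))
    else ?F (r - l + 1) ?Y"
  have "(\<Sum>r=1..length xs. ?h r) = (\<Sum>r=1..k + l - 1. ?h r)"
    using len by simp
  also have "\<dots> = (\<Sum>r\<in>{1..<i}. ?h r) + (\<Sum>s=1..l. ?h (s + i - 1))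
      + (\<Sum>r\<in>{i<..k}. ?h (r + l - 1))"
    by (rule sum_split_block[OF i])
  also have "(\<Sum>r\<in>{1..<i}. ?h r) = (\<Sum>r\<in>{1..<i}. ?F r ?Y)"
    by simp
  also have "(\<Sum>s=1..l. ?h (s + i - 1)) = (\<Sum>s=1..l. ?F i (?y s))"
    using i by (intro sum.cong) auto
  also have "\<dots> = ?F i ?Y"
    using multilin i len by (rule multilinear_replace_block_sum[symmetric])
  \<comment> \<open>For \<open>r > i\<close> the index \<open>r + l - 1\<close> is at least
    \<open>i + l\<close>, hence in the last branch, where the shift by \<open>l - 1\<close> is
    undone.\<close>
  also have "(\<Sum>r\<in>{i<..k}. ?h (r + l - 1)) = (\<Sum>r\<in>{i<..k}. ?F r ?Y)"
    by (intro sum.cong) auto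
  also have "(\<Sum>r\<in>{1..<i}. ?F r ?Y) + ?F i ?Y + (\<Sum>r\<in>{i<..k}. ?F r ?Y) = (\<Sum>r=1..k. ?F r ?Y)"
    \<comment> \<open>With block length 1 nothing is shifted and the middle piece is the single
      colour \<open>i\<close>.\<close>
    using sum_split_block[OF i, of "\<lambda>r. ?F r ?Y" 1] by simp
  finally show ?thesis
    \<comment> \<open>The Koszul sign is independent of the colour, so it factors out.\<close>
    by (simp only: diamond_def scale_sum_right[symmetric])
qed

end

theorem proposition6p9:
  fixes scale :: "'k::field_char_0 \<Rightarrow> 'd::ab_group_add \<Rightarrow> 'd"
    and D :: "int \<Rightarrow> 'd set"
    and \<theta> :: "nat \<Rightarrow> nat \<Rightarrow> 'w::semigroup_mult list \<Rightarrow> 'd list \<Rightarrow> 'd"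
  assumes "Dend_inf_family_algebra scale D \<theta>"
  shows "Omega_A_inf_algebra scale D (\<lambda>k \<alpha> xs. \<Sum>r=1..k. \<theta> k r \<alpha> xs)"
proof -
  interpret Dend_inf_family_algebra scale D \<theta> by fact
  have multilin: "multilinear k (\<theta> k r \<alpha>)" and deg: "degree_one k (\<theta> k r \<alpha>)"
    if "r \<in> {1..k}" "length \<alpha> = k" for k r \<alpha>
    using that Hom1_theta[of k] unfolding Hom1_family_def by auto
  show ?thesis
  proof
    fix k :: nat and \<alpha> :: "'w list"
    assume "length \<alpha> = k"
    then show "multilinear k (\<lambda>xs. \<Sum>r=1..k. \<theta> k r \<alpha> xs)"
      and "degree_one k (\<lambda>xs. \<Sum>r=1..k. \<theta> k r \<alpha> xs)"
      by (intro multilinear_sum degree_one_sum multilin deg; simp)+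
  next
    fix n and \<alpha> :: "'w list" and xs ds
    assume n: "1 \<le> n" "length \<alpha> = n" "length xs = n" "homogeneous ds xs"
    let ?P = "{(k, l). 1 \<le> k \<and> 1 \<le> l \<and> k + l = n + 1}"
    let ?\<nu> = "\<lambda>k \<alpha> xs. \<Sum>r=1..k. \<theta> k r \<alpha> xs"
    have "(\<Sum>(k, l)\<in>?P. \<Sum>i=1..k. scale (koszul_sign i ds)
        (?\<nu> k (merge_labels i l \<alpha>) (replace_block i l xs (?\<nu> l (block i l \<alpha>) (block i l xs))))) =
      (\<Sum>(k, l)\<in>?P. \<Sum>i=1..k. \<Sum>r=1..n. diamond i l (\<theta> k) (\<theta> l) r \<alpha> ds xs)"
    proof (intro sum.cong refl, clarify, intro sum.cong refl)
      fix k l i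
      assume kl: "k + l = n + 1" and i: "i \<in> {1..k}"
      \<comment> \<open>Merging \<open>l\<close> labels leaves \<open>n + 1 - l = k\<close> of them,
        the length at which \<open>multilin\<close> applies to \<open>\<theta> k i\<close>.\<close>
      have "length (merge_labels i l \<alpha>) = k"
        using n kl i by (simp add: merge_labels_def length_replace_block)
      then show "scale (koszul_sign i ds) (?\<nu> k (merge_labels i l \<alpha>)
            (replace_block i l xs (?\<nu> l (block i l \<alpha>) (block i l xs)))) =
          (\<Sum>r=1..n. diamond i l (\<theta> k) (\<theta> l) r \<alpha> ds xs)"
        using sum_diamond[of k "\<theta> k" i l \<alpha> xs "\<theta> l" ds] multilin n kl i by simp
    qed
    \<comment> \<open>The colour range \<open>{1..n}\<close> depends on none of \<open>k\<close>,
      \<open>l\<close>, \<open>i\<close>, so its sum can be moved outermost; each colour then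
      contributes one vanishing relation.\<close>
    also have "\<dots> = (\<Sum>(k, l)\<in>?P. \<Sum>r=1..n. \<Sum>i=1..k. diamond i l (\<theta> k) (\<theta> l) r \<alpha> ds xs)"
      by (intro sum.cong refl, clarify, rule sum.swap)
    also have "\<dots> = (\<Sum>r=1..n. \<Sum>(k, l)\<in>?P. \<Sum>i=1..k. diamond i l (\<theta> k) (\<theta> l) r \<alpha> ds xs)"
      unfolding case_prod_unfold by (rule sum.swap)
    also have "\<dots> = 0"
      using n by (intro sum.neutral ballI Dend_inf_relation) auto
    finally show "(\<Sum>(k, l)\<in>?P. \<Sum>i=1..k. scale (koszul_sign i ds)
        (?\<nu> k (merge_labels i l \<alpha>) (replace_block i l xs (?\<nu> l (block i l \<alpha>) (block i l xs))))) = 0" .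
  qed
qed

end
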